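(* Let $K$ be a field, let $J\subseteq I$ be monomial ideals in $R=K[x_1,\ldots,x_n]$, and let $1\leq j\leq n$. If $J$ is a demotion of $I$, then $J\setminus x_j$ is a demotion of $I\setminus x_j$.
   Context: For ideals $J\subseteq I$ in a commutative Noetherian ring $R$, $J$ is a demotion of $I$ if $I^rJ^s=I^{r+s}\cap J^s$ for all integers $r,s\geq 0$ (with $I^0=J^0=R$). For a monomial ideal $I$ with minimal set of monomial generators $\mathcal{G}(I)=\{u_1,\ldots,u_m\}$, the deletion $I\setminus x_j$ is the monomial ideal of $R\setminus x_j = K[x_i : i\neq j]$ generated by the elements obtained from $u_1,\ldots,u_m$ by setting $x_j=0$. *)

theory Defs
  imports "HOL-Library.Poly_Mapping" "HOL-Algebra.Ideal_Product"
begin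

text \<open>
  A polynomial in variables indexed by \<open>nat\<close> is a finitely supported map from exponent vectors
  to coefficients; \<open>Poly_Mapping\<close> provides its convolution product. The ring
  \<open>K[x_i : i \<in> V]\<close> is the subring of those polynomials in which only variables with index in
  \<open>V\<close> occur.
\<close>

type_synonym 'k mpoly = "(nat \<Rightarrow>\<^sub>0 nat) \<Rightarrow>\<^sub>0 'k"

definition mpoly_ring :: "nat set \<Rightarrow> 'k::field mpoly ring" where
  "mpoly_ring V =
    \<lparr>carrier = {p. \<forall>a \<in> Poly_Mapping.keys p. Poly_Mapping.keys a \<subseteq> V},
     mult = (*), one = 1, zero = 0, add = (+)\<rparr>"

definition mvar :: "nat \<Rightarrow> 'k::field mpoly" where
  "mvar i = Poly_Mapping.single (Poly_Mapping.single i 1) 1"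

definition monom_of :: "(nat \<Rightarrow>\<^sub>0 nat) \<Rightarrow> 'k::field mpoly" where
  "monom_of a = Poly_Mapping.single a 1"

definition monomials :: "nat set \<Rightarrow> 'k::field mpoly set" where
  "monomials V = monom_of ` {a. Poly_Mapping.keys a \<subseteq> V}"

definition monomial_ideal :: "nat set \<Rightarrow> 'k::field mpoly set \<Rightarrow> bool" where
  "monomial_ideal V I \<longleftrightarrow> (\<exists>M \<subseteq> monomials V. I = Idl\<^bsub>mpoly_ring V\<^esub> M)"

definition is_min_monomial_gens :: "nat set \<Rightarrow> 'k::field mpoly set \<Rightarrow> 'k mpoly set \<Rightarrow> bool" where
  "is_min_monomial_gens V I G \<longleftrightarrow>
     G \<subseteq> monomials V \<and> Idl\<^bsub>mpoly_ring V\<^esub> G = I \<and> (\<forall>H. H \<subset> G \<longrightarrow> Idl\<^bsub>mpoly_ring V\<^esub> H \<noteq> I)"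

text \<open>The description is proper for every monomial ideal: see \<open>min_monomial_gens_unique\<close> below.\<close>

definition min_monomial_gens :: "nat set \<Rightarrow> 'k::field mpoly set \<Rightarrow> 'k mpoly set" where
  "min_monomial_gens V I = (THE G. is_min_monomial_gens V I G)"

definition subst_poly :: "(nat \<Rightarrow> 'k::field mpoly) \<Rightarrow> 'k mpoly \<Rightarrow> 'k mpoly" where
  "subst_poly f p = (\<Sum>a \<in> Poly_Mapping.keys p. Poly_Mapping.single 0 (Poly_Mapping.lookup p a) *
     (\<Prod>i \<in> Poly_Mapping.keys a. f i ^ Poly_Mapping.lookup a i))"

definition set_var_zero :: "nat \<Rightarrow> 'k::field mpoly \<Rightarrow> 'k mpoly" where
  "set_var_zero j = subst_poly (\<lambda>i. if i = j then 0 else mvar i)"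

text \<open>The ideal is generated in the smaller ring \<open>K[x_i : i \<in> V - {j}]\<close>.\<close>

definition deletion :: "nat set \<Rightarrow> 'k::field mpoly set \<Rightarrow> nat \<Rightarrow> 'k mpoly set" where
  "deletion V I j = Idl\<^bsub>mpoly_ring (V - {j})\<^esub> (set_var_zero j ` min_monomial_gens V I)"

text \<open>
  Products and powers of ideals are those of the library structure \<open>ideals_set R\<close>, whose unit
  is \<open>carrier R\<close>, so that zeroth powers are the whole ring. The ambient ring is meant to be
  Noetherian; the definition itself does not use this.
\<close>

definition demotion :: "('a, 'b) ring_scheme \<Rightarrow> 'a set \<Rightarrow> 'a set \<Rightarrow> bool" where
  "demotion R J I \<longleftrightarrow> cring R \<and> ideal I R \<and> ideal J R \<and> J \<subseteq> I \<and>
     (\<forall>(r::nat) (s::nat).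
        (I [^]\<^bsub>ideals_set R\<^esub> r) \<otimes>\<^bsub>ideals_set R\<^esub> (J [^]\<^bsub>ideals_set R\<^esub> s) =
        (I [^]\<^bsub>ideals_set R\<^esub> (r + s)) \<inter> (J [^]\<^bsub>ideals_set R\<^esub> s))"


lemma mpoly_ring_simps [simp]:
  "p \<in> carrier (mpoly_ring V) \<longleftrightarrow> (\<forall>a \<in> Poly_Mapping.keys p. Poly_Mapping.keys a \<subseteq> V)"
  "mult (mpoly_ring V) = (*)" "one (mpoly_ring V) = 1"
  "zero (mpoly_ring V) = 0" "add (mpoly_ring V) = (+)"
  by (simp_all add: mpoly_ring_def)

lemma keys_add_exponents:
  fixes a b :: "nat \<Rightarrow>\<^sub>0 nat"
  shows "Poly_Mapping.keys (a + b) = Poly_Mapping.keys a \<union> Poly_Mapping.keys b"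
  by (auto simp: in_keys_iff lookup_add)

lemma mpoly_ring_cring: "cring (mpoly_ring V :: 'k::field mpoly ring)"
proof (rule cringI)
  show "abelian_group (mpoly_ring V :: 'k mpoly ring)"
  proof (rule abelian_groupI)
    fix x y z :: "'k mpoly"
    assume "x \<in> carrier (mpoly_ring V)" and "y \<in> carrier (mpoly_ring V)"
    then show "x \<oplus>\<^bsub>mpoly_ring V\<^esub> y \<in> carrier (mpoly_ring V)"
      using Poly_Mapping.keys_add[of x y] by auto
  next
    fix x :: "'k mpoly"
    assume "x \<in> carrier (mpoly_ring V)"
    then show "\<exists>y\<in>carrier (mpoly_ring V). y \<oplus>\<^bsub>mpoly_ring V\<^esub> x = \<zero>\<^bsub>mpoly_ring V\<^esub>"
      by (intro bexI[of _ "- x"]) auto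
  qed (auto simp: ac_simps)
  show "comm_monoid (mpoly_ring V :: 'k mpoly ring)"
  proof (rule comm_monoidI)
    fix x y :: "'k mpoly"
    assume "x \<in> carrier (mpoly_ring V)" and "y \<in> carrier (mpoly_ring V)"
    then show "x \<otimes>\<^bsub>mpoly_ring V\<^esub> y \<in> carrier (mpoly_ring V)"
      using Poly_Mapping.keys_mult[of x y] by (fastforce simp: keys_add_exponents)
  qed (auto simp: ac_simps)
qed (auto simp: algebra_simps)

lemma Idl_monomials:
  fixes A :: "(nat \<Rightarrow>\<^sub>0 nat) set"
  assumes A: "A \<subseteq> {a. Poly_Mapping.keys a \<subseteq> V}"
  shows "Idl\<^bsub>mpoly_ring V\<^esub> (monom_of ` A) =
    {p :: 'k::field mpoly. p \<in> carrier (mpoly_ring V) \<and>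
       (\<forall>b \<in> Poly_Mapping.keys p. \<exists>a \<in> A. \<exists>c. b = a + c)}" (is "_ = ?S")
proof -
  interpret R: cring "mpoly_ring V :: 'k mpoly ring" by (rule mpoly_ring_cring)
  let ?I = "Idl\<^bsub>mpoly_ring V\<^esub> (monom_of ` A) :: 'k mpoly set"
  have sub: "monom_of ` A \<subseteq> carrier (mpoly_ring V :: 'k mpoly ring)"
    using A by (auto simp: monom_of_def)
  interpret I: ideal ?I "mpoly_ring V :: 'k mpoly ring"
    by (rule R.genideal_ideal[OF sub])
  have mult_closed: "y * x \<in> ?S" if x: "x \<in> ?S" and y: "y \<in> carrier (mpoly_ring V)" for x y :: "'k mpoly"
  proof -
    have "y * x \<in> carrier (mpoly_ring V)" using x y R.m_closed[of y x] by simp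
    moreover have "\<exists>a\<in>A. \<exists>c. b = a + c" if "b \<in> Poly_Mapping.keys (y * x)" for b
    proof -
      obtain u v where "v \<in> Poly_Mapping.keys x" "b = u + v"
        using \<open>b \<in> Poly_Mapping.keys (y * x)\<close> Poly_Mapping.keys_mult[of y x] by auto
      moreover obtain a c where "a \<in> A" "v = a + c" using x calculation(1) by auto
      ultimately have "b = a + (u + c)" by (simp add: ac_simps)
      then show ?thesis using \<open>a \<in> A\<close> by blast
    qed
    ultimately show ?thesis by blast
  qed
  have "ideal ?S (mpoly_ring V)"
  proof (rule idealI)
    show "subgroup ?S (add_monoid (mpoly_ring V))"
    proof (rule R.add.subgroupI)
      show "?S \<subseteq> carrier (mpoly_ring V)" by blast
      have "0 \<in> ?S" by simp
      then show "?S \<noteq> {}" by blast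
    next
      fix x assume x: "x \<in> ?S"
      then have xc: "x \<in> carrier (mpoly_ring V)" by blast
      have mc: "- x \<in> carrier (mpoly_ring V)" using xc by simp
      have "x + - x = 0" by simp
      then have "\<ominus>\<^bsub>mpoly_ring V\<^esub> x = - x"
        using R.minus_equality[of "- x" x] xc mc by simp
      then show "\<ominus>\<^bsub>mpoly_ring V\<^esub> x \<in> ?S" using x by simp
    next
      fix x y assume "x \<in> ?S" "y \<in> ?S"
      then have "x + y \<in> ?S"
        using Poly_Mapping.keys_add[of x y] unfolding mpoly_ring_simps by blast
      then show "x \<oplus>\<^bsub>mpoly_ring V\<^esub> y \<in> ?S" by (simp only: mpoly_ring_simps)
    qed
  next
    fix a x :: "'k mpoly" assume ax: "a \<in> ?S" "x \<in> carrier (mpoly_ring V)"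
    show "x \<otimes>\<^bsub>mpoly_ring V\<^esub> a \<in> ?S" using mult_closed[OF ax] by (simp only: mpoly_ring_simps)
    show "a \<otimes>\<^bsub>mpoly_ring V\<^esub> x \<in> ?S"
      using mult_closed[OF ax] by (simp only: mpoly_ring_simps mult.commute[of a x])
  qed (rule R.ring_axioms)
  moreover have "monom_of ` A \<subseteq> ?S"
  proof -
    have "\<exists>a'\<in>A. \<exists>c. a = a' + c" if "a \<in> A" for a
      using that by (intro bexI[of _ a] exI[of _ 0]) simp_all
    then show ?thesis using A by (auto simp: monom_of_def)
  qed
  ultimately have "?I \<subseteq> ?S" by (rule R.genideal_minimal)
  moreover have "?S \<subseteq> ?I"
  proof
    fix p assume p: "p \<in> ?S"
    have term_in: "Poly_Mapping.single b (Poly_Mapping.lookup p b) \<in> ?I"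
      if b: "b \<in> Poly_Mapping.keys p" for b
    proof -
      obtain a c where a: "a \<in> A" "b = a + c" using p b by blast
      have "Poly_Mapping.keys b \<subseteq> V" using p b by simp
      then have "Poly_Mapping.keys c \<subseteq> V" by (simp add: a(2) keys_add_exponents)
      then have "Poly_Mapping.single c (Poly_Mapping.lookup p b) \<in> carrier (mpoly_ring V)" by simp
      moreover have "monom_of a \<in> ?I" using R.genideal_self[OF sub] a(1) by blast
      ultimately show ?thesis
        using I.I_l_closed[of "monom_of a" "Poly_Mapping.single c (Poly_Mapping.lookup p b)"]
        by (simp add: monom_of_def mult_single a(2) add.commute)
    qed
    have "(\<Sum>b\<in>B. Poly_Mapping.single b (Poly_Mapping.lookup p b)) \<in> ?I"
      if "finite B" "B \<subseteq> Poly_Mapping.keys p" for B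
      using that
    proof (induction B rule: finite_induct)
      case empty
      then show ?case using I.zero_closed by simp
    next
      case (insert b B)
      then show ?case using I.a_closed[OF term_in[of b]] by simp
    qed
    moreover have "(\<Sum>b\<in>Poly_Mapping.keys p. Poly_Mapping.single b (Poly_Mapping.lookup p b)) = p"
      by (rule poly_mapping_eqI) (simp add: lookup_sum lookup_single when_def in_keys_iff)
    ultimately show "p \<in> ?I" by (metis finite_keys order_refl)
  qed
  ultimately show ?thesis by blast
qed

lemma exponent_minimal_below:
  fixes a :: "nat \<Rightarrow>\<^sub>0 nat"
  assumes "a \<in> A"
  shows "\<exists>m c. m \<in> A \<and> a = m + c \<and> (\<forall>m' \<in> A. \<forall>c'. m = m' + c' \<longrightarrow> c' = 0)"
  using assms
proof (induction "\<Sum>i\<in>Poly_Mapping.keys a. Poly_Mapping.lookup a i" arbitrary: a rule: less_induct)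
  case less
  show ?case
  proof (cases "\<forall>m' \<in> A. \<forall>c'. a = m' + c' \<longrightarrow> c' = 0")
    case True
    then show ?thesis using less.prems by (intro exI[of _ a] exI[of _ 0]) simp
  next
    case False
    then obtain m' c' where m': "m' \<in> A" "a = m' + c'" "c' \<noteq> 0" by blast
    let ?K = "Poly_Mapping.keys m' \<union> Poly_Mapping.keys c'"
    have ext: "(\<Sum>i\<in>Poly_Mapping.keys u. Poly_Mapping.lookup u i) = (\<Sum>i\<in>?K. Poly_Mapping.lookup u i)"
      if "Poly_Mapping.keys u \<subseteq> ?K" for u :: "nat \<Rightarrow>\<^sub>0 nat"
      using that by (intro sum.mono_neutral_left) (auto simp: in_keys_iff)
    obtain i where "i \<in> Poly_Mapping.keys c'" using m'(3) by fastforce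
    then have "0 < (\<Sum>i\<in>?K. Poly_Mapping.lookup c' i)"
      by (intro sum_pos2[of _ i]) (auto simp: in_keys_iff)
    then have "(\<Sum>i\<in>Poly_Mapping.keys m'. Poly_Mapping.lookup m' i) <
        (\<Sum>i\<in>Poly_Mapping.keys a. Poly_Mapping.lookup a i)"
      by (subst (1 2) ext) (auto simp: m'(2) keys_add_exponents lookup_add sum.distrib)
    from less.hyps[OF this m'(1)] obtain m c where "m \<in> A" "m' = m + c"
      "\<forall>m' \<in> A. \<forall>c'. m = m' + c' \<longrightarrow> c' = 0" by blast
    then show ?thesis using m'(2) by (intro exI[of _ m] exI[of _ "c + c'"]) (simp add: ac_simps)
  qed
qed

lemma min_monomial_gens_unique:
  fixes I :: "'k::field mpoly set"
  assumes "monomial_ideal V I"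
  shows "\<exists>!G. is_min_monomial_gens V I G"
proof -
  let ?E = "{a. Poly_Mapping.keys a \<subseteq> V}"
  let ?mon = "monom_of :: _ \<Rightarrow> 'k mpoly"
  have inj: "inj ?mon"
    by (rule injI) (auto simp: monom_of_def dest: arg_cong[where f = Poly_Mapping.keys])
  have sub_mon: "\<exists>A. A \<subseteq> ?E \<and> G = ?mon ` A" if "G \<subseteq> monomials V" for G
    using that unfolding monomials_def by (meson subset_imageE)
  have mem: "?mon b \<in> Idl\<^bsub>mpoly_ring V\<^esub> (?mon ` A) \<longleftrightarrow> (\<exists>a\<in>A. \<exists>c. b = a + c)"
    if "A \<subseteq> ?E" "b \<in> ?E" for A b
    unfolding Idl_monomials[OF that(1)] using that(2) by (simp add: monom_of_def)
  have le: "Idl\<^bsub>mpoly_ring V\<^esub> (?mon ` A) \<subseteq> Idl\<^bsub>mpoly_ring V\<^esub> (?mon ` B)"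
    if "A \<subseteq> ?E" "B \<subseteq> ?E" "\<forall>a\<in>A. \<exists>b\<in>B. \<exists>c. a = b + c" for A B
  proof -
    have "\<exists>b\<in>B. \<exists>c. x = b + c" if x: "\<exists>a\<in>A. \<exists>c. x = a + c" for x
    proof -
      obtain a c where ac: "a \<in> A" "x = a + c" using x by blast
      obtain b d where bd: "b \<in> B" "a = b + d" using \<open>\<forall>a\<in>A. \<exists>b\<in>B. \<exists>c. a = b + c\<close> ac(1) by blast
      have "x = b + (d + c)" using ac(2) bd(2) by (simp add: ac_simps)
      then show ?thesis using bd(1) by blast
    qed
    then show ?thesis unfolding Idl_monomials[OF \<open>A \<subseteq> ?E\<close>] Idl_monomials[OF \<open>B \<subseteq> ?E\<close>] by blast
  qed
  obtain N where N: "N \<subseteq> monomials V" "I = Idl\<^bsub>mpoly_ring V\<^esub> N"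
    using assms unfolding monomial_ideal_def by blast
  obtain A where A: "A \<subseteq> ?E" and NA: "N = ?mon ` A"
    using sub_mon[OF N(1)] by blast
  have IA: "I = Idl\<^bsub>mpoly_ring V\<^esub> (?mon ` A)"
    using N(2) NA by simp
  define M where "M = {m \<in> A. \<forall>m' \<in> A. \<forall>c'. m = m' + c' \<longrightarrow> c' = 0}"
  have MA: "M \<subseteq> A" and ME: "M \<subseteq> ?E" using A by (auto simp: M_def)
  have below: "\<exists>m\<in>M. \<exists>c. a = m + c" if "a \<in> A" for a
    using exponent_minimal_below[OF that] unfolding M_def by blast
  have refl: "\<exists>b\<in>B. \<exists>c. a = b + c" if "a \<in> B" for a and B :: "(nat \<Rightarrow>\<^sub>0 nat) set"
    using that by (intro bexI[of _ a] exI[of _ 0]) simp_all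
  have IM: "Idl\<^bsub>mpoly_ring V\<^esub> (?mon ` M) = I"
    unfolding IA using le[OF ME A] le[OF A ME] below refl MA by blast
  have contains: "M \<subseteq> B" if BE: "B \<subseteq> ?E" and BI: "Idl\<^bsub>mpoly_ring V\<^esub> (?mon ` B) = I" for B
  proof
    fix m assume m: "m \<in> M"
    have "?mon m \<in> I" using mem[OF ME, of m] refl[OF m] m ME IM by blast
    then obtain b c where b: "b \<in> B" "m = b + c" using mem[OF BE, of m] BI m ME by blast
    have "?mon b \<in> I" using mem[OF BE, of b] refl[OF b(1)] b(1) BE BI by blast
    then obtain a d where a: "a \<in> A" "b = a + d" using mem[OF A, of b] IA b(1) BE by blast
    have "m = a + (d + c)" using a(2) b(2) by (simp add: ac_simps)
    then have "d + c = 0" using m a(1) unfolding M_def by blast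
    then have "Poly_Mapping.keys d \<union> Poly_Mapping.keys c = {}" by (metis keys_add_exponents keys_zero)
    then have "c = 0" by simp
    then show "m \<in> B" using b by simp
  qed
  show ?thesis
  proof (rule ex1I)
    have "H = ?mon ` M" if H: "H \<subseteq> ?mon ` M" "Idl\<^bsub>mpoly_ring V\<^esub> H = I" for H
    proof -
      obtain B where "B \<subseteq> M" "H = ?mon ` B"
        using H(1) unfolding subset_image_iff by blast
      moreover have "M \<subseteq> B"
        by (rule contains) (use calculation ME H(2) in auto)
      ultimately show ?thesis by blast
    qed
    then have "\<forall>H. H \<subset> ?mon ` M \<longrightarrow> Idl\<^bsub>mpoly_ring V\<^esub> H \<noteq> I" by (metis psubset_eq)
    moreover have "?mon ` M \<subseteq> monomials V"
      unfolding monomials_def using ME by (rule image_mono)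
    ultimately show "is_min_monomial_gens V I (?mon ` M)"
      using IM by (simp add: is_min_monomial_gens_def)
  next
    fix G assume "is_min_monomial_gens V I G"
    then have G: "G \<subseteq> monomials V" "Idl\<^bsub>mpoly_ring V\<^esub> G = I"
      and G_min: "\<And>H. H \<subset> G \<Longrightarrow> Idl\<^bsub>mpoly_ring V\<^esub> H \<noteq> I"
      unfolding is_min_monomial_gens_def by blast+
    obtain B where B: "B \<subseteq> ?E" "G = ?mon ` B" using sub_mon[OF G(1)] by blast
    have "M \<subseteq> B" by (rule contains[OF B(1)]) (use G(2) B(2) in simp)
    then have "?mon ` M \<subseteq> G" unfolding B(2) by (rule image_mono)
    then show "G = ?mon ` M" using G_min[of "?mon ` M"] IM by (auto simp: psubset_eq)
  qed
qed

end

theory Submission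
  imports Defs "HOL-Algebra.QuotRing"
begin

text \<open>
  Put \<open>R = K[x_i : i \<in> V]\<close> and \<open>S = K[x_i : i \<in> V - {j}]\<close>. Setting \<open>x_j = 0\<close> is a ring
  homomorphism \<open>h : R \<rightarrow> S\<close> that fixes \<open>S\<close>. A monomial ideal contains every monomial of each of
  its elements, and \<open>h\<close> only drops monomials; hence \<open>h\<close> maps each monomial ideal \<open>A\<close> into itself.
  For such an \<open>h\<close>-stable ideal the image \<open>h(A)\<close> is the contraction \<open>A \<inter> S\<close>.

  This double description carries the proof. As an image under a homomorphism, \<open>h(A)\<close> is
  compatible with products (\<open>image_ideal_prod\<close>) and with generating sets (\<open>image_genideal\<close>); as
  a contraction, it is compatible with intersections (\<open>image_inter_stable\<close>). Compatibility
  with generating sets identifies the deletion of \<open>I\<close> with \<open>h(I)\<close> (\<open>deletion_eq_image\<close>).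
  Stability passes to products and so to powers, and therefore applying \<open>h\<close> to both sides of
  \<open>I^r J^s = I^(r+s) \<inter> J^s\<close> gives the same identity for \<open>h(I)\<close> and \<open>h(J)\<close>
  (\<open>demotion_image\<close>). This last step is a general fact about retractions of commutative rings.
\<close>
section \<open>Retractions of rings and stable ideals\<close>

text \<open>
  The inclusion of the retract is required to be a homomorphism because the operations of \<open>S\<close>
  are a priori unrelated to those of \<open>R\<close>.
\<close>
locale ring_retraction = ring_hom_cring R S h
  for R :: "('a, 'b) ring_scheme" (structure) and S :: "('a, 'c) ring_scheme" (structure) and h +
  assumes incl_hom: "id \<in> ring_hom S R"
    and fixes_retract: "x \<in> carrier S \<Longrightarrow> h x = x"
begin

lemma retract_subset: "carrier S \<subseteq> carrier R"
  using ring_hom_closed[OF incl_hom] by auto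

lemma retract_mult: "\<lbrakk>x \<in> carrier S; y \<in> carrier S\<rbrakk> \<Longrightarrow> x \<otimes>\<^bsub>S\<^esub> y = x \<otimes> y"
  using ring_hom_mult[OF incl_hom, of x y] by simp

lemma retract_add: "\<lbrakk>x \<in> carrier S; y \<in> carrier S\<rbrakk> \<Longrightarrow> x \<oplus>\<^bsub>S\<^esub> y = x \<oplus> y"
  using ring_hom_add[OF incl_hom, of x y] by simp

lemma image_stable:
  assumes "A \<subseteq> carrier R" and "h ` A \<subseteq> A"
  shows "h ` A = A \<inter> carrier S"
proof
  show "h ` A \<subseteq> A \<inter> carrier S" using assms by auto
  show "A \<inter> carrier S \<subseteq> h ` A" using fixes_retract by force
qed

text \<open>
  A homomorphic image of an intersection can be smaller than the intersection of the images;
  for stable sets both sides are contractions to \<open>S\<close>, and contraction preserves intersections.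
\<close>
lemma image_inter_stable:
  assumes "A \<subseteq> carrier R" "h ` A \<subseteq> A" "B \<subseteq> carrier R" "h ` B \<subseteq> B"
  shows "h ` (A \<inter> B) = h ` A \<inter> h ` B"
proof -
  have "h ` (A \<inter> B) = (A \<inter> B) \<inter> carrier S" using assms by (intro image_stable) auto
  then show ?thesis using image_stable[OF assms(1,2)] image_stable[OF assms(3,4)] by blast
qed

text \<open>Being \<open>A \<inter> S\<close>, the image is the preimage of \<open>A\<close> under the inclusion of \<open>S\<close> in \<open>R\<close>.\<close>
lemma image_ideal:
  assumes "ideal A R" and "h ` A \<subseteq> A"
  shows "ideal (h ` A) S"
proof -
  interpret A: ideal A R by fact
  interpret incl: ring_hom_ring S R id
    by (intro ring_hom_ring.intro ring_hom_ring_axioms.intro S.ring_axioms R.ring_axioms incl_hom)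
  have "h ` A = {r \<in> carrier S. id r \<in> A}"
    using image_stable[OF A.a_subset assms(2)] by auto
  then show ?thesis using incl.ideal_vimage[OF assms(1)] by simp
qed

lemma image_ideal_prod:
  assumes A: "ideal A R" and B: "ideal B R"
  shows "h ` (A \<cdot>\<^bsub>R\<^esub> B) = (h ` A) \<cdot>\<^bsub>S\<^esub> (h ` B)"
proof
  interpret A: ideal A R by fact
  interpret B: ideal B R by fact
  have AB: "A \<cdot>\<^bsub>R\<^esub> B \<subseteq> carrier R" by (rule R.ideal_prod_in_carrier[OF A B])
  show "h ` (A \<cdot>\<^bsub>R\<^esub> B) \<subseteq> (h ` A) \<cdot>\<^bsub>S\<^esub> (h ` B)"
  proof (rule image_subsetI)
    fix x assume "x \<in> A \<cdot>\<^bsub>R\<^esub> B"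
    then show "h x \<in> (h ` A) \<cdot>\<^bsub>S\<^esub> (h ` B)"
    proof (induction rule: ideal_prod.induct)
      case (prod i j)
      then show ?case by (simp add: A.Icarr B.Icarr ideal_prod.prod)
    next
      case (sum x y)
      then have "x \<in> carrier R" "y \<in> carrier R" using AB by auto
      then show ?case using sum by (simp add: ideal_prod.sum)
    qed
  qed
  show "(h ` A) \<cdot>\<^bsub>S\<^esub> (h ` B) \<subseteq> h ` (A \<cdot>\<^bsub>R\<^esub> B)"
  proof
    fix y assume "y \<in> (h ` A) \<cdot>\<^bsub>S\<^esub> (h ` B)"
    then show "y \<in> h ` (A \<cdot>\<^bsub>R\<^esub> B)"
    proof (induction rule: ideal_prod.induct)
      case (prod i j)
      then obtain a b where ab: "a \<in> A" "b \<in> B" and ij: "i = h a" "j = h b" by blast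
      have "i \<otimes>\<^bsub>S\<^esub> j = h (a \<otimes> b)" using ab by (simp add: ij A.Icarr B.Icarr)
      then show ?case using ideal_prod.prod[OF ab, of R] by blast
    next
      case (sum s t)
      then obtain a b where ab: "a \<in> A \<cdot>\<^bsub>R\<^esub> B" "b \<in> A \<cdot>\<^bsub>R\<^esub> B" and st: "s = h a" "t = h b"
        by blast
      then have "a \<in> carrier R" "b \<in> carrier R" using AB by auto
      then have "s \<oplus>\<^bsub>S\<^esub> t = h (a \<oplus> b)" by (simp add: st)
      then show ?case using ideal_prod.sum[OF ab] by blast
    qed
  qed
qed

lemma ideal_prod_stable:
  assumes A: "ideal A R" "h ` A \<subseteq> A" and B: "ideal B R" "h ` B \<subseteq> B"
  shows "h ` (A \<cdot>\<^bsub>R\<^esub> B) \<subseteq> A \<cdot>\<^bsub>R\<^esub> B"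
proof -
  interpret A: ideal A R by fact
  interpret B: ideal B R by fact
  have AB: "A \<cdot>\<^bsub>R\<^esub> B \<subseteq> carrier R" by (rule R.ideal_prod_in_carrier[OF A(1) B(1)])
  have "h x \<in> A \<cdot>\<^bsub>R\<^esub> B" if "x \<in> A \<cdot>\<^bsub>R\<^esub> B" for x
    using that
  proof (induction rule: ideal_prod.induct)
    case (prod i j)
    then have "h (i \<otimes> j) = h i \<otimes> h j" by (simp add: A.Icarr B.Icarr retract_mult)
    moreover have "h i \<in> A" "h j \<in> B" using prod A(2) B(2) by auto
    ultimately show ?case by (simp add: ideal_prod.prod)
  next
    case (sum x y)
    then have "x \<in> carrier R" "y \<in> carrier R" using AB by auto
    then have "h (x \<oplus> y) = h x \<oplus> h y" by (simp add: retract_add)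
    then show ?case using sum by (simp add: ideal_prod.sum)
  qed
  then show ?thesis by blast
qed

text \<open>
  The three claims belong to one induction: passing to the next power needs the ideal property
  and the stability of the previous one. For the zeroth power, which is the whole ring, the
  image formula says that \<open>h\<close> is onto.
\<close>
lemma ideal_pow_image:
  fixes r :: nat
  assumes A: "ideal A R" "h ` A \<subseteq> A"
  shows "ideal (A [^]\<^bsub>ideals_set R\<^esub> r) R" (is "?ideal r")
    and "h ` (A [^]\<^bsub>ideals_set R\<^esub> r) \<subseteq> (A [^]\<^bsub>ideals_set R\<^esub> r)" (is "?stable r")
    and "h ` (A [^]\<^bsub>ideals_set R\<^esub> r) = ((h ` A) [^]\<^bsub>ideals_set S\<^esub> r)" (is "?image r")
proof -
  have "?ideal r \<and> ?stable r \<and> ?image r"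
  proof (induction r)
    case 0
    have "h ` carrier R \<subseteq> carrier R" using retract_subset by auto
    moreover have "h ` carrier R = carrier S"
      using image_stable[OF order_refl calculation] retract_subset by blast
    ultimately show ?case by (simp add: ideals_set_def R.oneideal)
  next
    case (Suc r)
    have "ideal ((A [^]\<^bsub>ideals_set R\<^esub> r) \<cdot>\<^bsub>R\<^esub> A) R"
      using Suc A(1) by (intro R.ideal_prod_is_ideal) auto
    moreover have "h ` ((A [^]\<^bsub>ideals_set R\<^esub> r) \<cdot>\<^bsub>R\<^esub> A) \<subseteq> (A [^]\<^bsub>ideals_set R\<^esub> r) \<cdot>\<^bsub>R\<^esub> A"
      using Suc A by (intro ideal_prod_stable) auto
    moreover have "h ` ((A [^]\<^bsub>ideals_set R\<^esub> r) \<cdot>\<^bsub>R\<^esub> A) = ((h ` A) [^]\<^bsub>ideals_set S\<^esub> r) \<cdot>\<^bsub>S\<^esub> (h ` A)"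
      using Suc A(1) image_ideal_prod[of "(A [^]\<^bsub>ideals_set R\<^esub> r)" A] by simp
    moreover have "mult (ideals_set R) = ideal_prod R" "mult (ideals_set S) = ideal_prod S"
      by (simp_all add: ideals_set_def)
    ultimately show ?case by simp
  qed
  then show "?ideal r" "?stable r" "?image r" by auto
qed

theorem demotion_image:
  assumes dem: "demotion R J I" and I: "h ` I \<subseteq> I" and J: "h ` J \<subseteq> J"
  shows "demotion S (h ` J) (h ` I)"
proof -
  have idI: "ideal I R" and idJ: "ideal J R" and JI: "J \<subseteq> I"
    and eq: "\<And>r s :: nat. (I [^]\<^bsub>ideals_set R\<^esub> r) \<cdot>\<^bsub>R\<^esub> (J [^]\<^bsub>ideals_set R\<^esub> s)
      = (I [^]\<^bsub>ideals_set R\<^esub> (r + s)) \<inter> (J [^]\<^bsub>ideals_set R\<^esub> s)"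
    using dem by (auto simp: demotion_def ideals_set_def)
  note powI = ideal_pow_image[OF idI I] and powJ = ideal_pow_image[OF idJ J]
  have "((h ` I) [^]\<^bsub>ideals_set S\<^esub> r) \<cdot>\<^bsub>S\<^esub> ((h ` J) [^]\<^bsub>ideals_set S\<^esub> s)
      = ((h ` I) [^]\<^bsub>ideals_set S\<^esub> (r + s)) \<inter> ((h ` J) [^]\<^bsub>ideals_set S\<^esub> s)" for r s :: nat
  proof -
    have "((h ` I) [^]\<^bsub>ideals_set S\<^esub> r) \<cdot>\<^bsub>S\<^esub> ((h ` J) [^]\<^bsub>ideals_set S\<^esub> s)
        = h ` ((I [^]\<^bsub>ideals_set R\<^esub> r) \<cdot>\<^bsub>R\<^esub> (J [^]\<^bsub>ideals_set R\<^esub> s))"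
      by (simp add: image_ideal_prod powI(1,3) powJ(1,3))
    also have "\<dots> = h ` ((I [^]\<^bsub>ideals_set R\<^esub> (r + s)) \<inter> (J [^]\<^bsub>ideals_set R\<^esub> s))"
      by (simp only: eq)
    also have "\<dots> = h ` (I [^]\<^bsub>ideals_set R\<^esub> (r + s)) \<inter> h ` (J [^]\<^bsub>ideals_set R\<^esub> s)"
      by (intro image_inter_stable powI(2) powJ(2) additive_subgroup.a_subset
          ideal.axioms(1) powI(1) powJ(1))
    finally show ?thesis by (simp only: powI(3) powJ(3))
  qed
  moreover have "mult (ideals_set S) = ideal_prod S" by (simp add: ideals_set_def)
  ultimately show ?thesis
    using image_ideal[OF idI I] image_ideal[OF idJ J] JI S.cring_axioms
    by (simp add: demotion_def image_mono)
qed

text \<open>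
  Each inclusion is minimality of a generated ideal: \<open>h (Idl M)\<close> is an ideal of \<open>S\<close> containing
  \<open>h M\<close>, and the preimage of \<open>Idl (h M)\<close> is an ideal of \<open>R\<close> containing \<open>M\<close>.
\<close>
lemma image_genideal:
  assumes M: "M \<subseteq> carrier R" and st: "h ` (Idl\<^bsub>R\<^esub> M) \<subseteq> Idl\<^bsub>R\<^esub> M"
  shows "h ` (Idl\<^bsub>R\<^esub> M) = Idl\<^bsub>S\<^esub> (h ` M)"
proof
  have hM: "h ` M \<subseteq> carrier S" using M by auto
  have "ideal (h ` (Idl\<^bsub>R\<^esub> M)) S" by (rule image_ideal[OF R.genideal_ideal[OF M] st])
  then show "Idl\<^bsub>S\<^esub> (h ` M) \<subseteq> h ` (Idl\<^bsub>R\<^esub> M)"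
    by (rule S.genideal_minimal) (intro image_mono R.genideal_self M)
  have "ideal {x \<in> carrier R. h x \<in> Idl\<^bsub>S\<^esub> (h ` M)} R"
    by (rule ring.ideal_vimage[OF S.genideal_ideal[OF hM]])
  moreover have "M \<subseteq> {x \<in> carrier R. h x \<in> Idl\<^bsub>S\<^esub> (h ` M)}"
    using M S.genideal_self[OF hM] by auto
  ultimately have "Idl\<^bsub>R\<^esub> M \<subseteq> {x \<in> carrier R. h x \<in> Idl\<^bsub>S\<^esub> (h ` M)}"
    by (rule R.genideal_minimal)
  then show "h ` (Idl\<^bsub>R\<^esub> M) \<subseteq> Idl\<^bsub>S\<^esub> (h ` M)" by blast
qed

end

section \<open>Setting a variable to zero\<close>

lemma prod_mvar_power:
  "(\<Prod>i\<in>Poly_Mapping.keys a. mvar i ^ Poly_Mapping.lookup a i) = (monom_of a :: 'k::field mpoly)"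
proof -
  have monom_add: "monom_of (b + c) = (monom_of b * monom_of c :: 'k mpoly)" for b c
    by (simp add: monom_of_def mult_single)
  have monom_0: "monom_of 0 = (1 :: 'k mpoly)" by (simp add: monom_of_def)
  have pow: "mvar i ^ k = (monom_of (Poly_Mapping.single i k) :: 'k mpoly)" for i k
  proof (induction k)
    case 0
    show ?case by (simp add: monom_0)
  next
    case (Suc k)
    have "Poly_Mapping.single i (Suc k) = Poly_Mapping.single i 1 + Poly_Mapping.single i k"
      by (simp flip: single_add)
    moreover have "mvar i = (monom_of (Poly_Mapping.single i 1) :: 'k mpoly)"
      by (simp add: mvar_def monom_of_def)
    ultimately show ?case by (metis Suc monom_add power_Suc)
  qed
  have prod: "(\<Prod>i\<in>B. monom_of (f i)) = (monom_of (\<Sum>i\<in>B. f i) :: 'k mpoly)" if "finite B"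
    for B :: "nat set" and f
    using that by induction (simp_all add: monom_0 monom_add)
  have "(\<Sum>i\<in>Poly_Mapping.keys a. Poly_Mapping.single i (Poly_Mapping.lookup a i)) = a"
    by (rule poly_mapping_eqI) (simp add: lookup_sum lookup_single when_def in_keys_iff)
  then show ?thesis by (simp add: pow prod)
qed

text \<open>
  Substitution sends \<open>x^b\<close> to \<open>0\<close> if \<open>x_j\<close> divides it and to \<open>x^b\<close> otherwise. So setting \<open>x_j = 0\<close>
  is a truncation that can be computed coefficient by coefficient.
\<close>
lemma lookup_set_var_zero:
  fixes p :: "'k::field mpoly"
  shows "Poly_Mapping.lookup (set_var_zero j p) a =
    (if j \<in> Poly_Mapping.keys a then 0 else Poly_Mapping.lookup p a)"
proof -
  let ?f = "\<lambda>i. if i = j then 0 else mvar i :: 'k mpoly"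
  have prod: "(\<Prod>i\<in>Poly_Mapping.keys b. ?f i ^ Poly_Mapping.lookup b i)
      = (if j \<in> Poly_Mapping.keys b then 0 else monom_of b)" for b
  proof (cases "j \<in> Poly_Mapping.keys b")
    case True
    then show ?thesis by (auto simp: in_keys_iff intro!: prod_zero bexI[of _ j])
  next
    case False
    then have "(\<Prod>i\<in>Poly_Mapping.keys b. ?f i ^ Poly_Mapping.lookup b i)
        = (\<Prod>i\<in>Poly_Mapping.keys b. mvar i ^ Poly_Mapping.lookup b i)"
      by (intro prod.cong) auto
    then show ?thesis using False by (simp add: prod_mvar_power)
  qed
  have "set_var_zero j p = (\<Sum>b\<in>Poly_Mapping.keys p.
      if j \<in> Poly_Mapping.keys b then 0 else Poly_Mapping.single b (Poly_Mapping.lookup p b))"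
    unfolding set_var_zero_def subst_poly_def prod
    by (intro sum.cong) (auto simp: monom_of_def mult_single)
  then have "Poly_Mapping.lookup (set_var_zero j p) a = (\<Sum>b\<in>Poly_Mapping.keys p. Poly_Mapping.lookup
      (if j \<in> Poly_Mapping.keys b then 0 else Poly_Mapping.single b (Poly_Mapping.lookup p b)) a)"
    by (simp only: lookup_sum)
  also have "\<dots> = (\<Sum>b\<in>Poly_Mapping.keys p.
      if b = a then (if j \<in> Poly_Mapping.keys a then 0 else Poly_Mapping.lookup p a) else 0)"
    by (intro sum.cong) (auto simp: lookup_single when_def)
  finally show ?thesis by (auto simp: not_in_keys_iff_lookup_eq_zero)
qed

lemma keys_set_var_zero:
  "Poly_Mapping.keys (set_var_zero j p) = {a \<in> Poly_Mapping.keys p. j \<notin> Poly_Mapping.keys a}"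
  by (auto simp: in_keys_iff[of _ "set_var_zero j p"] in_keys_iff[of _ p] lookup_set_var_zero
      split: if_splits)

lemma set_var_zero_id:
  assumes "\<And>a. a \<in> Poly_Mapping.keys p \<Longrightarrow> j \<notin> Poly_Mapping.keys a"
  shows "set_var_zero j p = p"
proof (rule poly_mapping_eqI)
  show "Poly_Mapping.lookup (set_var_zero j p) a = Poly_Mapping.lookup p a" for a
    using assms[of a] by (cases "a \<in> Poly_Mapping.keys p") (auto simp: lookup_set_var_zero in_keys_iff)
qed

lemma set_var_zero_eq_0_iff:
  "set_var_zero j p = 0 \<longleftrightarrow> (\<forall>a\<in>Poly_Mapping.keys p. j \<in> Poly_Mapping.keys a)"
  by (subst keys_eq_empty[symmetric]) (auto simp: keys_set_var_zero)

lemma set_var_zero_add: "set_var_zero j (p + q) = set_var_zero j p + set_var_zero j q"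
  by (rule poly_mapping_eqI) (simp add: lookup_set_var_zero lookup_add)

text \<open>
  The kernel of truncation consists of the polynomials in which \<open>x_j\<close> divides every monomial, so
  it absorbs products. Both \<open>p\<close> and \<open>q\<close> agree with their truncations modulo the kernel, and a
  product of truncations is free of \<open>x_j\<close>, hence unchanged by truncation.
\<close>
lemma set_var_zero_mult:
  fixes p q :: "'k::field mpoly"
  shows "set_var_zero j (p * q) = set_var_zero j p * set_var_zero j q"
proof -
  let ?h = "set_var_zero j :: 'k mpoly \<Rightarrow> 'k mpoly"
  have kill: "?h (x * y) = 0" if "?h x = 0" for x y
    using that keys_mult[of x y] unfolding set_var_zero_eq_0_iff
    by (fastforce simp: keys_add_exponents)
  have ker: "?h (x - ?h x) = 0" for x
    by (rule poly_mapping_eqI) (simp add: lookup_set_var_zero lookup_minus)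
  have "p * q = ?h p * ?h q + ((p - ?h p) * q + (q - ?h q) * ?h p)"
    by (simp add: algebra_simps)
  then have "?h (p * q) = ?h (?h p * ?h q)"
    using kill[OF ker, of p q] kill[OF ker, of q "?h p"] set_var_zero_add[of j]
    by (metis add.right_neutral)
  also have "\<dots> = ?h p * ?h q"
  proof (rule set_var_zero_id)
    fix a assume "a \<in> Poly_Mapping.keys (?h p * ?h q)"
    then show "j \<notin> Poly_Mapping.keys a"
      using keys_mult[of "?h p" "?h q"] by (auto simp: keys_set_var_zero keys_add_exponents)
  qed
  finally show ?thesis .
qed

lemma set_var_zero_retraction:
  "ring_retraction (mpoly_ring V :: 'k::field mpoly ring) (mpoly_ring (V - {j})) (set_var_zero j)"
proof -
  have one: "set_var_zero j 1 = (1 :: 'k mpoly)" by (rule set_var_zero_id) auto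
  interpret R: cring "mpoly_ring V :: 'k mpoly ring" by (rule mpoly_ring_cring)
  interpret S: cring "mpoly_ring (V - {j}) :: 'k mpoly ring" by (rule mpoly_ring_cring)
  show ?thesis
  proof
    show "set_var_zero j \<in> ring_hom (mpoly_ring V) (mpoly_ring (V - {j}) :: 'k mpoly ring)"
      by (rule ring_hom_memI)
        (auto simp: keys_set_var_zero set_var_zero_mult set_var_zero_add one)
    show "id \<in> ring_hom (mpoly_ring (V - {j})) (mpoly_ring V :: 'k mpoly ring)"
      by (rule ring_hom_memI) auto
    show "set_var_zero j p = p" if "p \<in> carrier (mpoly_ring (V - {j}))" for p :: "'k mpoly"
      using that by (intro set_var_zero_id) auto
  qed
qed

text \<open>
  Membership in a monomial ideal is a condition on each monomial of a polynomial separately, so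
  it survives dropping monomials.
\<close>
lemma monomial_ideal_stable:
  assumes "monomial_ideal V I"
  shows "set_var_zero j ` I \<subseteq> I"
proof -
  obtain A where A: "A \<subseteq> {a. Poly_Mapping.keys a \<subseteq> V}" "I = Idl\<^bsub>mpoly_ring V\<^esub> (monom_of ` A)"
    using assms unfolding monomial_ideal_def monomials_def by (metis subset_imageE)
  show ?thesis unfolding A(2) Idl_monomials[OF A(1)] by (auto simp: keys_set_var_zero)
qed

text \<open>
  Deletion is defined through generators, but stability of \<open>I\<close> lets \<open>h\<close> commute with generating
  an ideal, so setting \<open>x_j = 0\<close> in the generators amounts to applying \<open>h\<close> to all of \<open>I\<close>.
\<close>
lemma deletion_eq_image:
  fixes I :: "'k::field mpoly set"
  assumes I: "monomial_ideal V I"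
  shows "deletion V I j = set_var_zero j ` I"
proof -
  interpret ring_retraction "mpoly_ring V :: 'k mpoly ring" "mpoly_ring (V - {j})" "set_var_zero j"
    by (rule set_var_zero_retraction)
  let ?G = "min_monomial_gens V I"
  have "is_min_monomial_gens V I ?G"
    unfolding min_monomial_gens_def by (rule theI'[OF min_monomial_gens_unique[OF I]])
  then have G: "?G \<subseteq> monomials V" "Idl\<^bsub>mpoly_ring V\<^esub> ?G = I"
    unfolding is_min_monomial_gens_def by blast+
  have "?G \<subseteq> carrier (mpoly_ring V)" using G(1) by (auto simp: monomials_def monom_of_def)
  from image_genideal[OF this] show ?thesis
    unfolding deletion_def G(2) using monomial_ideal_stable[OF I] by simp
qed

theorem proposition5p7:
  fixes I J :: "'k::field mpoly set" and n j :: nat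
  assumes "monomial_ideal {1..n} I" and "monomial_ideal {1..n} J" and "J \<subseteq> I"
    and "1 \<le> j" and "j \<le> n"
    and "demotion (mpoly_ring {1..n}) J I"
  shows "demotion (mpoly_ring ({1..n} - {j})) (deletion {1..n} J j) (deletion {1..n} I j)"
  unfolding deletion_eq_image[OF assms(1)] deletion_eq_image[OF assms(2)]
  by (rule ring_retraction.demotion_image[OF set_var_zero_retraction assms(6)])
    (rule monomial_ideal_stable[OF assms(1)], rule monomial_ideal_stable[OF assms(2)])

end
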